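(* Let $m\ge1$ and $r\ge2$ be integers, $B\subset\mathbb C^m$ the open Euclidean unit ball, and $V$ a complex vector space of dimension $r$. Suppose $0\le\rho_1<\rho_2<\rho$, and a metric $h$ on the trivial bundle $F'=\rho B\times V\to\rho B$ has semipositive curvature. Assume that \[ h(s,\cdot)=h(s',\cdot)\qquad\text{whenever}\quad \|s\|=\|s'\|=\rho_2 . \] Then $h(s,\cdot)\ge h(s',\cdot)$ whenever $\|s\|=\rho_1$, $\|s'\|=\rho_2$.
   Context: A hermitian metric on a finite dimensional complex vector space is a function of the form $v\mapsto\hat h(v,v)$, with $\hat h$ a positive definite hermitian form. A (hermitian) metric on a holomorphic vector bundle $E\to S$ is a function $h:E\to\mathbb R$ on the total space whose restriction to each fiber is a hermitian metric in this sense (no continuity is required a priori). The metric $h$ is seminegatively curved if $h$ is plurisubharmonic on the total space $E$; it is semipositively curved if the dual metric $h^*$ on the dual bundle $E^*$ is seminegatively curved. $\rho B=\{s\in\mathbb C^m:\|s\|<\rho\}$, with $\|\ \|$ the Euclidean norm; $h(s,\cdot)$ denotes the hermitian metric $v\mapsto h(s,v)$ on $V$. *)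

theory Defs
  imports "HOL-Analysis.Analysis" "HOL-Library.Function_Algebras"
begin

text \<open>
  A complex vector space is given by a type \<open>'v\<close> of class \<open>ab_group_add\<close> together with a scalar
  multiplication \<open>smulV\<close> satisfying \<open>vector_space smulV\<close>. A metric is the quadratic function
  \<open>v \<mapsto> H v v\<close> (a squared norm), not the norm itself.
\<close>

definition hermitian_form ::
    "(complex \<Rightarrow> 'v \<Rightarrow> 'v) \<Rightarrow> ('v::ab_group_add \<Rightarrow> 'v \<Rightarrow> complex) \<Rightarrow> bool" where
  "hermitian_form smulV H \<longleftrightarrow>
     (\<forall>w. Vector_Spaces.linear smulV (*) (\<lambda>v. H v w)) \<and> (\<forall>v w. H w v = cnj (H v w))"

definition positive_definite_form :: "('v::ab_group_add \<Rightarrow> 'v \<Rightarrow> complex) \<Rightarrow> bool" where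
  "positive_definite_form H \<longleftrightarrow> (\<forall>v. v \<noteq> 0 \<longrightarrow> H v v \<in> \<real> \<and> 0 < Re (H v v))"

definition hermitian_metric ::
    "(complex \<Rightarrow> 'v \<Rightarrow> 'v) \<Rightarrow> ('v::ab_group_add \<Rightarrow> real) \<Rightarrow> bool" where
  "hermitian_metric smulV g \<longleftrightarrow>
     (\<exists>H. hermitian_form smulV H \<and> positive_definite_form H \<and> (\<forall>v. of_real (g v) = H v v))"

text \<open>
  A metric on the trivial bundle with base \<open>U\<close> and fibre the whole type \<open>'v\<close>; values of \<open>h\<close>
  outside the total space \<open>U \<times> UNIV\<close> are irrelevant throughout.
\<close>

definition bundle_metric ::
    "(complex \<Rightarrow> 'v \<Rightarrow> 'v) \<Rightarrow> 's set \<Rightarrow> ('s \<times> 'v::ab_group_add \<Rightarrow> real) \<Rightarrow> bool" where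
  "bundle_metric smulV U h \<longleftrightarrow> (\<forall>s\<in>U. hermitian_metric smulV (\<lambda>v. h (s, v)))"

text \<open>
  The dual space is a subset of the function type \<open>'v \<Rightarrow> complex\<close>, whose topology is that of
  pointwise convergence. For finite-dimensional \<open>'v\<close> this induces on the dual space its canonical
  topology as a finite-dimensional complex vector space, so none is needed on \<open>'v\<close> itself.
\<close>

definition dual_space :: "(complex \<Rightarrow> 'v \<Rightarrow> 'v) \<Rightarrow> ('v::ab_group_add \<Rightarrow> complex) set" where
  "dual_space smulV = {\<xi>. Vector_Spaces.linear smulV (*) \<xi>}"

definition dual_metric :: "('s \<times> 'v \<Rightarrow> real) \<Rightarrow> 's \<times> ('v \<Rightarrow> complex) \<Rightarrow> real" where
  "dual_metric h = (\<lambda>(s, \<xi>). SUP v\<in>{v. h (s, v) \<le> 1}. (cmod (\<xi> v))\<^sup>2)"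

definition upper_semicontinuous_on :: "'e::topological_space set \<Rightarrow> ('e \<Rightarrow> real) \<Rightarrow> bool" where
  "upper_semicontinuous_on \<Omega> u \<longleftrightarrow> (\<forall>c. openin (top_of_set \<Omega>) {x \<in> \<Omega>. u x < c})"

text \<open>
  Plurisubharmonicity of a real-valued function on an open subset \<open>\<Omega>\<close> of a finite-dimensional
  complex vector space with scalar multiplication \<open>smulW\<close>; that space may be a proper subspace of
  the type \<open>'e\<close>. The submean inequality is required for every closed affine disc contained in
  \<open>\<Omega>\<close>. On a circle the integral of an upper semicontinuous function exists in \<open>[-\<infinity>, \<infinity>)\<close>;
  as \<open>u a\<close> is finite, the submean inequality excludes the value \<open>-\<infinity>\<close>. Integrability is therefore
  part of the inequality, and it is stated because the integral of a non-integrable function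
  is \<open>0\<close> by convention.
\<close>

definition plurisubharmonic_on ::
    "(complex \<Rightarrow> 'e \<Rightarrow> 'e) \<Rightarrow> 'e::{topological_space,ab_group_add} set \<Rightarrow> ('e \<Rightarrow> real) \<Rightarrow> bool" where
  "plurisubharmonic_on smulW \<Omega> u \<longleftrightarrow>
     upper_semicontinuous_on \<Omega> u \<and>
     (\<forall>a b. (\<forall>\<zeta>. cmod \<zeta> \<le> 1 \<longrightarrow> a + smulW \<zeta> b \<in> \<Omega>) \<longrightarrow>
        (\<lambda>t. u (a + smulW (cis t) b)) absolutely_integrable_on {0..2 * pi} \<and>
        u a \<le> 1 / (2 * pi) * integral {0..2 * pi} (\<lambda>t. u (a + smulW (cis t) b)))"

text \<open>
  Here \<open>W\<close> is the fibre, a finite-dimensional subspace of \<open>'w\<close> with scalar multiplication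
  \<open>smulW\<close>, and \<open>U \<times> W\<close> is the total space.
\<close>

definition seminegatively_curved ::
    "(complex \<Rightarrow> 'w \<Rightarrow> 'w) \<Rightarrow> (complex ^ 'm) set \<Rightarrow> 'w::{topological_space,ab_group_add} set \<Rightarrow>
     ((complex ^ 'm) \<times> 'w \<Rightarrow> real) \<Rightarrow> bool" where
  "seminegatively_curved smulW U W g \<longleftrightarrow>
     plurisubharmonic_on (\<lambda>\<zeta> (t, w). (\<zeta> *s t, smulW \<zeta> w)) (U \<times> W) g"

definition semipositively_curved ::
    "(complex \<Rightarrow> 'v \<Rightarrow> 'v) \<Rightarrow> (complex ^ 'm) set \<Rightarrow>
     ((complex ^ 'm) \<times> 'v::ab_group_add \<Rightarrow> real) \<Rightarrow> bool" where
  "semipositively_curved smulV U h \<longleftrightarrow>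
     seminegatively_curved (\<lambda>\<zeta> \<xi> v. \<zeta> * \<xi> v) U (dual_space smulV) (dual_metric h)"

end

theory Submission
  imports Defs
begin

text \<open>
  For a fixed functional \<open>\<xi>\<close> the function \<open>s \<mapsto> h\<^sup>*(s, \<xi>)\<close> is plurisubharmonic, and it
  is constant on the sphere of radius \<open>\<rho>\<^sub>2\<close>, so the maximum principle bounds it inside by its value on
  that sphere. Hence \<open>h\<^sup>*(s, \<xi>) \<le> h\<^sup>*(s', \<xi>)\<close> for all \<open>\<xi>\<close>, and taking for \<open>\<xi>\<close> the functional that
  represents \<open>v\<close> with respect to \<open>h(s', \<cdot>)\<close> reverses this to \<open>h(s', v) \<le> h(s, v)\<close>.
\<close>

section \<open>Hermitian forms\<close>

locale hermitian_space = vector_space smul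
  for smul :: "complex \<Rightarrow> 'v::ab_group_add \<Rightarrow> 'v" +
  fixes H :: "'v \<Rightarrow> 'v \<Rightarrow> complex"
  assumes hermitian: "hermitian_form smul H"
    and positive_definite: "positive_definite_form H"
begin

lemma linear_left: "Vector_Spaces.linear smul (*) (\<lambda>v. H v w)"
  using hermitian unfolding hermitian_form_def by blast

lemma conj_sym: "H w v = cnj (H v w)"
  using hermitian unfolding hermitian_form_def by blast

lemma add_left: "H (x + y) w = H x w + H y w"
  using linear_left[of w] by (simp add: Vector_Spaces.linear_iff)

lemma scale_left: "H (smul c x) w = c * H x w"
  using linear_left[of w] by (simp add: Vector_Spaces.linear_iff)

lemma zero_left [simp]: "H 0 w = 0"
  using add_left[of 0 0 w] by simp

lemma diff_left: "H (x - y) w = H x w - H y w"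
  using add_left[of "x - y" y w] by simp

lemma add_right: "H w (x + y) = H w x + H w y"
  by (metis add_left complex_cnj_add conj_sym)

lemma scale_right: "H w (smul c x) = cnj c * H w x"
  by (metis complex_cnj_mult scale_left conj_sym)

lemma zero_right [simp]: "H w 0 = 0"
  using add_right[of w 0 0] by simp

lemma diff_right: "H w (x - y) = H w x - H w y"
  using add_right[of w "x - y" y] by simp

lemma diag_pos: "v \<noteq> 0 \<Longrightarrow> 0 < Re (H v v)"
  using positive_definite by (simp add: positive_definite_form_def)

lemma diag_nonneg: "0 \<le> Re (H v v)"
  using diag_pos[of v] by (cases "v = 0") auto

lemma of_real_diag: "of_real (Re (H v v)) = H v v"
  using arg_cong[OF conj_sym[of v v], of Im] by (simp add: complex_eq_iff)

lemma Cauchy_Schwarz: "(cmod (H v w))\<^sup>2 \<le> Re (H v v) * Re (H w w)"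
proof (cases "w = 0")
  case False
  define q where "q = Re (H w w)"
  have q: "0 < q" "H w w = of_real q"
    using diag_pos[OF False] of_real_diag[of w] by (simp_all add: q_def)
  define x where "x = smul (of_real q) v - smul (H v w) w"
  have "H x x = of_real q * (of_real q * H v v - H v w * cnj (H v w))"
    by (simp add: x_def diff_left diff_right scale_left scale_right q(2) conj_sym[of w v] algebra_simps)
  also have "\<dots> = of_real (q * (q * Re (H v v) - (cmod (H v w))\<^sup>2))"
    by (simp add: complex_norm_square[symmetric] of_real_diag)
  finally have "0 \<le> q * (q * Re (H v v) - (cmod (H v w))\<^sup>2)"
    using diag_nonneg[of x] by (metis Re_complex_of_real)
  then show ?thesis
    using q(1) by (simp add: zero_le_mult_iff q_def mult.commute)
qed simp

lemma orthogonal_projection_span: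
  assumes "finite S"
  shows "\<exists>p\<in>span S. \<forall>x\<in>span S. H x (v - p) = 0"
  using assms
proof (induction S arbitrary: v rule: finite_induct)
  case empty
  then show ?case by simp
next
  case (insert a S)
  obtain p where p: "p \<in> span S" "\<And>x. x \<in> span S \<Longrightarrow> H x (v - p) = 0"
    using insert.IH[of v] by auto
  obtain q where q: "q \<in> span S" "\<And>x. x \<in> span S \<Longrightarrow> H x (a - q) = 0"
    using insert.IH[of a] by auto
  define e where "e = a - q"
  have sub: "span S \<subseteq> span (insert a S)"
    by (rule span_mono) auto
  have e: "e \<in> span (insert a S)"
    unfolding e_def using subsetD[OF sub q(1)] by (intro span_diff) (auto intro: span_base)
  \<comment> \<open>If \<open>e = 0\<close>, then \<open>c = 0\<close> by division by zero, and \<open>p\<close> is already the projection.\<close>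
  define c where "c = cnj (H e (v - p) / H e e)"
  have ce: "cnj c * H e e = H e (v - p)"
  proof (cases "e = 0")
    case False
    then have "H e e \<noteq> 0"
      using diag_pos by fastforce
    then show ?thesis by (simp add: c_def)
  qed simp
  show ?case
  proof (intro bexI ballI)
    show "p + smul c e \<in> span (insert a S)"
      using p(1) sub e by (intro span_add span_scale) auto
    fix x assume "x \<in> span (insert a S)"
    then obtain k where k: "x - smul k a \<in> span S"
      by (auto simp: span_insert)
    define y where "y = x - smul k e"
    have "y = (x - smul k a) + smul k q"
      by (simp add: y_def e_def scale_right_diff_distrib)
    then have y: "y \<in> span S"
      using k q(1) by (auto intro: span_add span_scale)
    have "H y (v - (p + smul c e)) = 0"
      using p(2)[OF y] q(2)[OF y] by (simp add: diff_right add_right scale_right e_def)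
    moreover have "H e (v - (p + smul c e)) = 0"
      using ce by (simp add: diff_right add_right scale_right)
    moreover have "x = y + smul k e"
      by (simp add: y_def)
    ultimately show "H x (v - (p + smul c e)) = 0"
      by (simp add: add_left scale_left)
  qed
qed

end

lemma finite_dimensional_if_dim_pos:
  assumes "vector_space smul" and "0 < vector_space.dim smul UNIV"
  shows "\<exists>B. finite_dimensional_vector_space smul B"
proof -
  interpret vector_space smul by fact
  obtain B where B: "independent B" "UNIV \<subseteq> span B" "card B = dim UNIV"
    using basis_exists by blast
  have "finite B"
    using B(3) assms(2) card_gt_0_iff by fastforce
  then have "finite_dimensional_vector_space smul B"
    using B by unfold_locales auto
  then show ?thesis by blast
qed

lemma (in hermitian_space) linear_functional_bounded:
  assumes "finite_dimensional_vector_space smul B"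
    and \<xi>: "Vector_Spaces.linear smul (*) \<xi>"
  shows "\<exists>C\<ge>0. \<forall>w. (cmod (\<xi> w))\<^sup>2 \<le> C * Re (H w w)"
proof (cases "\<forall>w. \<xi> w = 0")
  case True
  then show ?thesis by (intro exI[of _ 0]) auto
next
  case False
  interpret finite_dimensional_vector_space smul B by fact
  interpret \<xi>: Vector_Spaces.linear smul "(*)" \<xi> by fact
  obtain v where v: "\<xi> v \<noteq> 0" using False by blast
  define N where "N = {w. \<xi> w = 0}"
  have "subspace N"
    unfolding N_def by (rule \<xi>.subspace_kernel)
  obtain S where S: "S \<subseteq> N" "independent S" "N \<subseteq> span S"
    using basis_exists[of N] by metis
  have "span S = N"
    using span_minimal[OF S(1) \<open>subspace N\<close>] S(3) by (rule subset_antisym)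
  then obtain p where p: "p \<in> N" "\<And>x. x \<in> N \<Longrightarrow> H x (v - p) = 0"
    using orthogonal_projection_span[OF finiteI_independent[OF S(2)], of v] by auto
  define e where "e = v - p"
  have \<xi>e: "\<xi> e = \<xi> v"
    using p(1) by (simp add: e_def \<xi>.diff N_def)
  then have "e \<noteq> 0" using v \<xi>.zero by auto
  define q where "q = Re (H e e)"
  have q: "0 < q" "H e e = of_real q"
    using diag_pos[OF \<open>e \<noteq> 0\<close>] of_real_diag[of e] by (simp_all add: q_def)
  show ?thesis
  proof (intro exI conjI allI)
    show "0 \<le> (cmod (\<xi> v))\<^sup>2 / q" using q by simp
    fix w
    have "w - smul (\<xi> w / \<xi> v) e \<in> N"
      using v \<xi>e by (simp add: N_def \<xi>.diff \<xi>.scale)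
    then have "H w e = \<xi> w / \<xi> v * of_real q"
      using p(2) by (fastforce simp: e_def[symmetric] diff_left scale_left q(2))
    then have "(cmod (\<xi> w))\<^sup>2 / (cmod (\<xi> v))\<^sup>2 * q\<^sup>2 \<le> Re (H w w) * q"
      using Cauchy_Schwarz[of w e]
      by (simp add: q_def[symmetric] norm_mult norm_divide power_mult_distrib power_divide)
    then have "q * ((cmod (\<xi> w))\<^sup>2 * q) \<le> q * ((cmod (\<xi> v))\<^sup>2 * Re (H w w))"
      using v by (simp add: field_simps power2_eq_square)
    then have "(cmod (\<xi> w))\<^sup>2 * q \<le> (cmod (\<xi> v))\<^sup>2 * Re (H w w)"
      using q(1) by simp
    then show "(cmod (\<xi> w))\<^sup>2 \<le> (cmod (\<xi> v))\<^sup>2 / q * Re (H w w)"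
      using q(1) by (simp add: field_simps)
  qed
qed

lemma hermitian_metric_imp_hermitian_space:
  assumes "vector_space smul" and "hermitian_metric smul g"
  obtains H where "hermitian_space smul H" and "\<And>v. g v = Re (H v v)"
proof -
  obtain H where H: "hermitian_form smul H" "positive_definite_form H"
      "\<And>v. of_real (g v) = H v v"
    using assms(2) unfolding hermitian_metric_def by blast
  have "hermitian_space smul H"
    using assms(1) H by (intro hermitian_space.intro hermitian_space_axioms.intro)
  moreover have "g v = Re (H v v)" for v
    by (simp add: H(3)[symmetric])
  ultimately show ?thesis by (rule that)
qed

lemma metric_antimono_dual_metric:
  assumes "vector_space smul" and "0 < vector_space.dim smul UNIV"
    and "hermitian_metric smul (\<lambda>v. h (s, v))"
    and "hermitian_metric smul (\<lambda>v. h (s', v))"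
    and dual_le: "\<And>\<xi>. \<xi> \<in> dual_space smul \<Longrightarrow> dual_metric h (s, \<xi>) \<le> dual_metric h (s', \<xi>)"
  shows "h (s', v) \<le> h (s, v)"
proof -
  obtain G where G: "hermitian_space smul G" "\<And>v. h (s, v) = Re (G v v)"
    using hermitian_metric_imp_hermitian_space[OF assms(1,3)] by blast
  obtain H where H: "hermitian_space smul H" "\<And>v. h (s', v) = Re (H v v)"
    using hermitian_metric_imp_hermitian_space[OF assms(1,4)] by blast
  interpret G: hermitian_space smul G by fact
  interpret H: hermitian_space smul H by fact
  show ?thesis
  proof (cases "v = 0")
    case True
    then show ?thesis by (simp add: G(2) H(2))
  next
    case False
    define g where "g = h (s, v)"
    define k where "k = h (s', v)"
    have pos: "0 < g" "0 < k"
      using G.diag_pos[OF False] H.diag_pos[OF False] by (simp_all add: g_def k_def G(2) H(2))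
    define \<xi> where "\<xi> = (\<lambda>w. H w v)"
    have \<xi>: "Vector_Spaces.linear smul (*) \<xi>"
      unfolding \<xi>_def by (rule H.linear_left)
    obtain C where C: "0 \<le> C" "\<And>w. (cmod (\<xi> w))\<^sup>2 \<le> C * h (s, w)"
      using G.linear_functional_bounded[OF _ \<xi>] finite_dimensional_if_dim_pos[OF assms(1,2)] G(2)
      by metis
    define c where "c = complex_of_real (1 / sqrt g)"
    have "h (s, smul c v) = g * (cmod c)\<^sup>2"
      by (simp add: G(2) G.scale_left G.scale_right g_def c_def norm_divide)
         (simp add: power2_eq_square)
    also have "\<dots> = 1"
      using pos by (simp add: c_def norm_divide power_divide)
    finally have unit: "h (s, smul c v) = 1" .
    have "k\<^sup>2 / g = (cmod (\<xi> (smul c v)))\<^sup>2"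
      using pos H.of_real_diag[of v, symmetric]
      by (simp add: \<xi>_def H.scale_left H(2)[symmetric] k_def[symmetric] c_def norm_mult norm_divide
          power_divide)
    also have "\<dots> \<le> dual_metric h (s, \<xi>)"
      unfolding dual_metric_def case_prod_conv
    proof (rule cSUP_upper)
      show "bdd_above ((\<lambda>v. (cmod (\<xi> v))\<^sup>2) ` {v. h (s, v) \<le> 1})"
        using C by (intro bdd_aboveI2[of _ _ C]) (metis mem_Collect_eq mult_left_le order_trans)
    qed (simp add: unit)
    also have "\<dots> \<le> dual_metric h (s', \<xi>)"
      using dual_le \<xi> by (simp add: dual_space_def)
    also have "\<dots> \<le> k"
      unfolding dual_metric_def case_prod_conv
    proof (rule cSUP_least)
      have "0 \<in> {w. h (s', w) \<le> 1}" by (simp add: H(2))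
      then show "{w. h (s', w) \<le> 1} \<noteq> {}" by blast
      fix w assume "w \<in> {w. h (s', w) \<le> 1}"
      then have "h (s', w) * k \<le> 1 * k"
        using pos by (intro mult_right_mono) auto
      then show "(cmod (\<xi> w))\<^sup>2 \<le> k"
        using H.Cauchy_Schwarz[of w v] by (simp add: \<xi>_def H(2) k_def)
    qed
    finally show ?thesis
      using pos by (simp add: field_simps power2_eq_square g_def k_def)
  qed
qed

section \<open>The maximum principle\<close>

lemma upper_semicontinuous_on_compose:
  assumes "upper_semicontinuous_on T u" and "continuous_on S f" and "f ` S \<subseteq> T"
  shows "upper_semicontinuous_on S (\<lambda>x. u (f x))"
  unfolding upper_semicontinuous_on_def
proof
  fix c
  have "openin (top_of_set S) (S \<inter> f -` {x \<in> T. u x < c})"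
    using assms by (intro continuous_openin_preimage[of _ _ T]) (auto simp: upper_semicontinuous_on_def)
  moreover have "S \<inter> f -` {x \<in> T. u x < c} = {x \<in> S. u (f x) < c}"
    using assms(3) by auto
  ultimately show "openin (top_of_set S) {x \<in> S. u (f x) < c}" by simp
qed

lemma upper_semicontinuous_on_add_continuous:
  assumes "upper_semicontinuous_on S u" and "continuous_on S g"
  shows "upper_semicontinuous_on S (\<lambda>x. u x + g x)"
  unfolding upper_semicontinuous_on_def
proof
  fix c
  have "{x \<in> S. u x + g x < c} = (\<Union>q. {x \<in> S. u x < q} \<inter> (S \<inter> g -` {..<c - q}))"
  proof (intro subset_antisym subsetI)
    fix x assume x: "x \<in> {x \<in> S. u x + g x < c}"
    then have "u x < c - g x" by auto
    then obtain q where "u x < q" "q < c - g x"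
      using dense by blast
    then show "x \<in> (\<Union>q. {x \<in> S. u x < q} \<inter> (S \<inter> g -` {..<c - q}))"
      using x by (auto intro!: exI[of _ q])
  qed auto
  moreover have "openin (top_of_set S) (\<Union>q. {x \<in> S. u x < q} \<inter> (S \<inter> g -` {..<c - q}))"
    using assms
    by (intro openin_Union ballI)
       (auto simp: upper_semicontinuous_on_def intro!: openin_Int continuous_openin_preimage_gen)
  ultimately show "openin (top_of_set S) {x \<in> S. u x + g x < c}" by simp
qed

lemma upper_semicontinuous_on_attains_sup:
  assumes "compact K" and "K \<noteq> {}" and usc: "upper_semicontinuous_on K u"
  shows "\<exists>x\<in>K. \<forall>y\<in>K. u y \<le> u x"
proof (rule ccontr)
  assume "\<not> ?thesis"
  then have above: "\<exists>y\<in>K. u x < u y" if "x \<in> K" for x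
    using that by (meson not_le)
  have "\<exists>T. open T \<and> {x \<in> K. u x < u y} = K \<inter> T" for y
    using usc by (simp add: upper_semicontinuous_on_def openin_open)
  then obtain T where T: "\<And>y. open (T y)" "\<And>y. {x \<in> K. u x < u y} = K \<inter> T y"
    by metis
  have "K \<subseteq> (\<Union>y\<in>K. T y)"
    using above T(2) by blast
  then obtain F where F: "F \<subseteq> K" "finite F" "K \<subseteq> (\<Union>y\<in>F. T y)"
    using compactE_image[OF assms(1), of K T] T(1) by blast
  have "F \<noteq> {}" using F(3) assms(2) by auto
  then have "Max (u ` F) \<in> u ` F"
    using F(2) by (intro Max_in) auto
  then obtain z where "z \<in> F" "u z = Max (u ` F)" by auto
  then have z: "z \<in> F" "\<And>y. y \<in> F \<Longrightarrow> u y \<le> u z"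
    using F(2) by simp_all
  then obtain y where "y \<in> F" "z \<in> T y"
    using F by blast
  then have "u z < u y"
    using T(2)[of y] z(1) F(1) by blast
  then show False
    using z(2)[OF \<open>y \<in> F\<close>] by simp
qed

lemma norm_vector_scalar_mult_complex:
  fixes x :: "complex ^ 'm"
  shows "norm (c *s x) = cmod c * norm x"
  by (simp add: norm_vec_def norm_mult L2_set_right_distrib)

text \<open>
  Adding a small multiple of \<open>\<parallel>s\<parallel>\<^sup>2\<close> makes the function strictly plurisubharmonic, so that it has no
  interior maximum; averaging over the directions \<open>b\<close> and \<open>- b\<close> removes the mixed terms of
  \<open>\<parallel>s + \<zeta> b\<parallel>\<^sup>2\<close> by the parallelogram law.
\<close>

lemma plurisubharmonic_on_maximum_principle:
  fixes u :: "complex ^ 'm \<Rightarrow> real"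
  assumes psh: "plurisubharmonic_on (*s) \<Omega> u"
    and K: "compact K" "K \<subseteq> \<Omega>"
    and boundary: "\<And>s. s \<in> frontier K \<Longrightarrow> u s \<le> M"
    and "s \<in> K"
  shows "u s \<le> M"
proof (rule field_le_epsilon)
  fix e :: real assume "0 < e"
  obtain C where C: "0 < C" "\<And>x. x \<in> K \<Longrightarrow> norm x \<le> C"
    using compact_imp_bounded[OF K(1)] bounded_pos by blast
  define \<epsilon> where "\<epsilon> = e / C\<^sup>2"
  have \<epsilon>: "0 < \<epsilon>" "\<epsilon> * C\<^sup>2 = e"
    using \<open>0 < e\<close> C(1) by (simp_all add: \<epsilon>_def)
  define f where "f = (\<lambda>x. u x + \<epsilon> * (norm x)\<^sup>2)"
  have "upper_semicontinuous_on K u"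
    using psh K(2) upper_semicontinuous_on_compose[of \<Omega> u K "\<lambda>x. x"]
    by (simp add: plurisubharmonic_on_def)
  then have "upper_semicontinuous_on K f"
    unfolding f_def by (intro upper_semicontinuous_on_add_continuous continuous_intros)
  then obtain p where p: "p \<in> K" "\<And>x. x \<in> K \<Longrightarrow> f x \<le> f p"
    using upper_semicontinuous_on_attains_sup[OF K(1)] \<open>s \<in> K\<close> by blast
  have "p \<notin> interior K"
  proof
    assume "p \<in> interior K"
    then obtain d where d: "0 < d" "cball p d \<subseteq> K"
      by (meson mem_interior_cball)
    obtain b :: "complex ^ 'm" where b: "norm b = d"
      using vector_choose_size[of d] d(1) by auto
    have disc: "p + \<zeta> *s c \<in> K" if "norm c = d" "cmod \<zeta> \<le> 1" for \<zeta> c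
      using that d by (intro subsetD[OF d(2)])
        (simp add: dist_norm norm_vector_scalar_mult_complex mult_left_le_one_le)
    define I where "I = (\<lambda>c. integral {0..2 * pi} (\<lambda>t. u (p + cis t *s c)))"
    have int: "(\<lambda>t. u (p + cis t *s c)) integrable_on {0..2 * pi}"
      and mean: "2 * pi * u p \<le> I c" if "norm c = d" for c
    proof -
      have "(\<lambda>t. u (p + cis t *s c)) absolutely_integrable_on {0..2 * pi}
          \<and> u p \<le> 1 / (2 * pi) * I c"
        using psh disc[OF that] K(2) unfolding plurisubharmonic_on_def I_def by blast
      then show "(\<lambda>t. u (p + cis t *s c)) integrable_on {0..2 * pi}"
        and "2 * pi * u p \<le> I c"
        using set_lebesgue_integral_eq_integral(1) by (auto simp: field_simps)
    qed
    have "2 * (2 * pi * u p) \<le> I b + I (- b)"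
      using mean[of b] mean[of "- b"] b by simp
    also have "\<dots> = integral {0..2 * pi} (\<lambda>t. u (p + cis t *s b) + u (p + cis t *s (- b)))"
      unfolding I_def using int[of b] int[of "- b"] b by (simp add: integral_add)
    also have "\<dots> \<le> integral {0..2 * pi} (\<lambda>t. 2 * (u p - \<epsilon> * d\<^sup>2))"
    proof (rule integral_le)
      show "(\<lambda>t. u (p + cis t *s b) + u (p + cis t *s (- b))) integrable_on {0..2 * pi}"
        using int[of b] int[of "- b"] b by (intro integrable_add) auto
      fix t
      define w where "w = cis t *s b"
      have w: "p + cis t *s (- b) = p - w" "norm w = d"
        using b by (simp_all add: w_def norm_vector_scalar_mult_complex vec_eq_iff)
      have "u (p + w) + \<epsilon> * (norm (p + w))\<^sup>2 \<le> u p + \<epsilon> * (norm p)\<^sup>2"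
        using p(2)[of "p + w"] disc[of b "cis t"] b by (simp add: f_def w_def)
      moreover have "u (p - w) + \<epsilon> * (norm (p - w))\<^sup>2 \<le> u p + \<epsilon> * (norm p)\<^sup>2"
        using p(2)[OF disc[of "- b" "cis t", unfolded w(1)]] b by (simp add: f_def)
      moreover have "\<epsilon> * (norm (p + w))\<^sup>2 + \<epsilon> * (norm (p - w))\<^sup>2 = 2 * (\<epsilon> * (norm p)\<^sup>2 + \<epsilon> * d\<^sup>2)"
        unfolding w(2)[symmetric] by (simp add: power2_norm_eq_inner inner_simps inner_commute algebra_simps)
      ultimately have "u (p + w) + u (p - w) \<le> 2 * (u p - \<epsilon> * d\<^sup>2)"
        by argo
      then show "u (p + cis t *s b) + u (p + cis t *s (- b)) \<le> 2 * (u p - \<epsilon> * d\<^sup>2)"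
        by (simp add: w(1)) (simp add: w_def)
    qed (rule integrable_const_ivl)
    also have "\<dots> = 2 * (2 * pi * (u p - \<epsilon> * d\<^sup>2))"
      by simp
    finally have "u p \<le> u p - \<epsilon> * d\<^sup>2"
      using pi_gt_zero by simp
    then show False
      using \<epsilon>(1) d(1) by (simp add: mult_le_0_iff)
  qed
  then have "u p \<le> M"
    using boundary p(1) compact_imp_closed[OF K(1)] by (simp add: frontier_def)
  have "u s \<le> f s"
    using \<epsilon>(1) by (simp add: f_def)
  also have "\<dots> \<le> f p"
    using p(2) \<open>s \<in> K\<close> by blast
  also have "\<dots> \<le> M + \<epsilon> * C\<^sup>2"
    unfolding f_def using \<epsilon>(1) C(2)[OF p(1)] \<open>u p \<le> M\<close>
    by (intro add_mono mult_left_mono power_mono) auto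
  finally show "u s \<le> M + e"
    using \<epsilon>(2) by simp
qed

lemma seminegatively_curved_constant_section:
  assumes curv: "seminegatively_curved smulW U W g" and "w \<in> W" and zero: "\<And>\<zeta>. smulW \<zeta> 0 = 0"
  shows "plurisubharmonic_on (*s) U (\<lambda>s. g (s, w))"
  unfolding plurisubharmonic_on_def
proof (intro conjI allI impI)
  let ?m = "\<lambda>\<zeta> (t, w). (\<zeta> *s t, smulW \<zeta> w)"
  have psh: "plurisubharmonic_on ?m (U \<times> W) g"
    using curv by (simp add: seminegatively_curved_def)
  then have "upper_semicontinuous_on (U \<times> W) g"
    unfolding plurisubharmonic_on_def by (rule conjunct1)
  then show "upper_semicontinuous_on U (\<lambda>s. g (s, w))"
    by (rule upper_semicontinuous_on_compose[where f = "\<lambda>s. (s, w)"])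
       (use \<open>w \<in> W\<close> in \<open>auto intro!: continuous_intros\<close>)
  fix a b assume disc: "\<forall>\<zeta>. cmod \<zeta> \<le> 1 \<longrightarrow> a + \<zeta> *s b \<in> U"
  have slice: "(a, w) + ?m \<zeta> (b, 0) = (a + \<zeta> *s b, w)" for \<zeta>
    by (simp add: zero)
  have "\<forall>\<zeta>. cmod \<zeta> \<le> 1 \<longrightarrow> (a, w) + ?m \<zeta> (b, 0) \<in> U \<times> W"
    unfolding slice using disc \<open>w \<in> W\<close> by simp
  then have "(\<lambda>t. g ((a, w) + ?m (cis t) (b, 0))) absolutely_integrable_on {0..2 * pi} \<and>
      g (a, w) \<le> 1 / (2 * pi) * integral {0..2 * pi} (\<lambda>t. g ((a, w) + ?m (cis t) (b, 0)))"
    using psh unfolding plurisubharmonic_on_def by blast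
  then show "(\<lambda>t. g (a + cis t *s b, w)) absolutely_integrable_on {0..2 * pi}"
    and "g (a, w) \<le> 1 / (2 * pi) * integral {0..2 * pi} (\<lambda>t. g (a + cis t *s b, w))"
    unfolding slice by blast+
qed

theorem lemma4p3:
  fixes smulV :: "complex \<Rightarrow> 'v \<Rightarrow> 'v::ab_group_add"
    and r :: nat
    and \<rho>\<^sub>1 \<rho>\<^sub>2 \<rho> :: real
    and h :: "(complex ^ 'm) \<times> 'v \<Rightarrow> real"
  assumes "vector_space smulV"
    and "r \<ge> 2"
    and "vector_space.dim smulV (UNIV :: 'v set) = r"
    and "0 \<le> \<rho>\<^sub>1" "\<rho>\<^sub>1 < \<rho>\<^sub>2" "\<rho>\<^sub>2 < \<rho>"
    and "bundle_metric smulV (ball 0 \<rho>) h"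
    and "semipositively_curved smulV (ball 0 \<rho>) h"
    and "\<And>s s' v. norm s = \<rho>\<^sub>2 \<Longrightarrow> norm s' = \<rho>\<^sub>2 \<Longrightarrow> h (s, v) = h (s', v)"
  shows "\<forall>s s' v. norm s = \<rho>\<^sub>1 \<longrightarrow> norm s' = \<rho>\<^sub>2 \<longrightarrow> h (s, v) \<ge> h (s', v)"
proof (intro allI impI)
  fix s s' :: "complex ^ 'm" and v
  assume s: "norm s = \<rho>\<^sub>1" and s': "norm s' = \<rho>\<^sub>2"
  have dual_le: "dual_metric h (s, \<xi>) \<le> dual_metric h (s', \<xi>)" if "\<xi> \<in> dual_space smulV" for \<xi>
  proof (rule plurisubharmonic_on_maximum_principle[where K = "cball 0 \<rho>\<^sub>2"])
    show "plurisubharmonic_on (*s) (ball 0 \<rho>) (\<lambda>s. dual_metric h (s, \<xi>))"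
      using assms(8) that unfolding semipositively_curved_def
      by (rule seminegatively_curved_constant_section) (simp add: fun_eq_iff)
    show "dual_metric h (x, \<xi>) \<le> dual_metric h (s', \<xi>)"
      if "x \<in> frontier (cball 0 \<rho>\<^sub>2)" for x :: "complex ^ 'm"
    proof -
      have "norm x = \<rho>\<^sub>2" using that by simp
      then have "\<And>v. h (x, v) = h (s', v)" using assms(9) s' by blast
      then show ?thesis by (simp add: dual_metric_def)
    qed
  qed (use assms(5,6) s in auto)
  show "h (s', v) \<le> h (s, v)"
  proof (rule metric_antimono_dual_metric[OF assms(1)])
    show "0 < vector_space.dim smulV (UNIV :: 'v set)"
      using assms(2,3) by simp
    show "hermitian_metric smulV (\<lambda>v. h (s, v))" "hermitian_metric smulV (\<lambda>v. h (s', v))"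
      using assms(5-7) s s' by (auto simp: bundle_metric_def)
  qed (rule dual_le)
qed

end
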